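(* There is an absolute constant $C>0$ such that the following holds. Let $n\ge2$ and let $f:\mathbb{S}^n\to\mathbb{R}$ be convex (not necessarily smooth), with $f^*=\min_{\mathbf{X}\in\mathcal{S}_n}f(\mathbf{X})$. Suppose that there exist a minimizer $\mathbf{X}^*$ of $f$ over $\mathcal{S}_n$ and a subgradient $\mathbf{G}^*\in\partial f(\mathbf{X}^* )$ such that $\langle\mathbf{X}-\mathbf{X}^*,\mathbf{G}^*\rangle\ge0$ for all $\mathbf{X}\in\mathcal{S}_n$ and $\delta:=\lambda_{n-1}(\mathbf{G}^* )-\lambda_n(\mathbf{G}^* )>0$. Let $f_{(\alpha,\beta)}$ be an $(\alpha,\beta)$-smooth approximation of $f$ ($\alpha,\beta>0$) and let $0<\hat\delta\le\delta$. Then the iterates $\{\mathbf{X}_t\}_{t\ge1}$ of the regularized Frank-Wolfe algorithm described in the context, applied to $f_{(\alpha,\beta)}$ with parameters $\beta$ and $\hat\delta$, satisfy $$\forall t\ge0:\quad f(\mathbf{X}_{t+1})-f^*\le\left(f(\mathbf{X}_1)-f^*\right)\exp\Big(-\min\Big\{\frac12,\frac{\hat\delta}{4\beta}\Big\}t\Big)+C\alpha.$$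
   Context: $\mathbb{S}^n$ is the space of real symmetric $n\times n$ matrices with the trace inner product $\langle\cdot,\cdot\rangle$ and Frobenius norm $\Vert\cdot\Vert_F$. $\mathcal{S}_n=\{\mathbf{X}\in\mathbb{S}^n : \mathbf{X}\succeq 0,\ \mathrm{Tr}(\mathbf{X})=1\}$. Eigenvalues of a symmetric matrix are ordered $\lambda_1\ge\dots\ge\lambda_n$. A function is $\beta$-smooth if it is differentiable with $\beta$-Lipschitz gradient in the Frobenius norm. A convex function $f_{(\alpha,\beta)}:\mathbb{S}^n\to\mathbb{R}$ is an $(\alpha,\beta)$-smooth approximation of $f$ if $|f(\mathbf{X})-f_{(\alpha,\beta)}(\mathbf{X})|\le\alpha$ for all $\mathbf{X}\in\mathbb{S}^n$ and $f_{(\alpha,\beta)}$ is $\beta$-smooth. Regularized Frank-Wolfe algorithm applied to a $\beta$-smooth function $q$ with inputs $\beta,\hat\delta$: $\mathbf{X}_1$ is an arbitrary point of $\mathcal{S}_n$; $\eta=\min\{1,\frac{\hat\delta}{2\beta}\}$. For $t=1,2,\dots$: let $\mathbf{v}_t\in\arg\min_{\mathbf{v}\in\mathbb{R}^n,\Vert\mathbf{v}\Vert_2=1}\langle\mathbf{v}\mathbf{v}^\top,\nabla q(\mathbf{X}_t)\rangle+\frac{\eta\beta}{2}\Vert\mathbf{v}\mathbf{v}^\top-\mathbf{X}_t\Vert_F^2$ (computed exactly), and set $\mathbf{X}_{t+1}=(1-\eta)\mathbf{X}_t+\eta\mathbf{v}_t\mathbf{v}_t^\top$. *)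

theory Defs
  imports Complex_Main "Jordan_Normal_Form.Matrix" "Jordan_Normal_Form.Char_Poly"
begin

text \<open>
  The dimension \<open>n\<close> has to be quantified inside the statement, below the absolute constant. Hence
  matrices are elements of \<^typ>\<open>real mat\<close> with explicit carriers, and a function on the space of
  symmetric matrices is a function on \<^typ>\<open>real mat\<close> whose values outside \<open>sym_mats n\<close>
  are never used.
\<close>

definition sym_mats :: "nat \<Rightarrow> real mat set" where
  "sym_mats n = {A \<in> carrier_mat n n. transpose_mat A = A}"

definition trace_mat :: "real mat \<Rightarrow> real" where
  "trace_mat A = (\<Sum>i<dim_row A. A $$ (i, i))"

definition inner_mat :: "real mat \<Rightarrow> real mat \<Rightarrow> real" where
  "inner_mat A B = trace_mat (transpose_mat A * B)"

definition frob_norm :: "real mat \<Rightarrow> real" where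
  "frob_norm A = sqrt (inner_mat A A)"

definition l2_norm :: "real vec \<Rightarrow> real" where
  "l2_norm v = sqrt (v \<bullet> v)"

definition outer_sq :: "real vec \<Rightarrow> real mat" where
  "outer_sq v = mat (dim_vec v) (dim_vec v) (\<lambda>(i, j). v $ i * v $ j)"

definition psd :: "nat \<Rightarrow> real mat \<Rightarrow> bool" where
  "psd n A \<longleftrightarrow> (\<forall>v \<in> carrier_vec n. 0 \<le> v \<bullet> (A *\<^sub>v v))"

definition spectrahedron :: "nat \<Rightarrow> real mat set" where
  "spectrahedron n = {A \<in> sym_mats n. psd n A \<and> trace_mat A = 1}"

text \<open>
  Eigenvalues are listed with algebraic multiplicity, in descending order and numbered from 1.
  A symmetric \<open>n \<times> n\<close> matrix has \<open>n\<close> of them.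
\<close>

definition eigvals_desc :: "real mat \<Rightarrow> real list" where
  "eigvals_desc A = rev (sorted_list_of_multiset (proots (char_poly A)))"

definition eigval :: "nat \<Rightarrow> real mat \<Rightarrow> real" where
  "eigval i A = eigvals_desc A ! (i - 1)"

definition convex_fun :: "nat \<Rightarrow> (real mat \<Rightarrow> real) \<Rightarrow> bool" where
  "convex_fun n f \<longleftrightarrow>
     (\<forall>X \<in> sym_mats n. \<forall>Y \<in> sym_mats n. \<forall>u. 0 \<le> u \<and> u \<le> 1 \<longrightarrow>
        f ((1 - u) \<cdot>\<^sub>m X + u \<cdot>\<^sub>m Y) \<le> (1 - u) * f X + u * f Y)"

definition subdifferential :: "nat \<Rightarrow> (real mat \<Rightarrow> real) \<Rightarrow> real mat \<Rightarrow> real mat set" where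
  "subdifferential n f X =
     {G \<in> sym_mats n. \<forall>Y \<in> sym_mats n. f X + inner_mat (Y - X) G \<le> f Y}"

text \<open>
  Frechet gradient within the space of symmetric matrices: the increments \<open>H\<close> are symmetric
  and so is the gradient.
\<close>

definition is_gradient :: "nat \<Rightarrow> (real mat \<Rightarrow> real) \<Rightarrow> real mat \<Rightarrow> real mat \<Rightarrow> bool" where
  "is_gradient n q X G \<longleftrightarrow> G \<in> sym_mats n \<and>
     (\<forall>\<epsilon>>0. \<exists>d>0. \<forall>H \<in> sym_mats n. frob_norm H < d \<longrightarrow>
        \<bar>q (X + H) - q X - inner_mat H G\<bar> \<le> \<epsilon> * frob_norm H)"

definition grad :: "nat \<Rightarrow> (real mat \<Rightarrow> real) \<Rightarrow> real mat \<Rightarrow> real mat" where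
  "grad n q X = (THE G. is_gradient n q X G)"

definition smooth_fun :: "nat \<Rightarrow> real \<Rightarrow> (real mat \<Rightarrow> real) \<Rightarrow> bool" where
  "smooth_fun n \<beta> q \<longleftrightarrow>
     (\<forall>X \<in> sym_mats n. \<exists>G. is_gradient n q X G) \<and>
     (\<forall>X \<in> sym_mats n. \<forall>Y \<in> sym_mats n.
        frob_norm (grad n q X - grad n q Y) \<le> \<beta> * frob_norm (X - Y))"

definition smooth_approx ::
    "nat \<Rightarrow> real \<Rightarrow> real \<Rightarrow> (real mat \<Rightarrow> real) \<Rightarrow> (real mat \<Rightarrow> real) \<Rightarrow> bool" where
  "smooth_approx n \<alpha> \<beta> f q \<longleftrightarrow>
     convex_fun n q \<and> (\<forall>X \<in> sym_mats n. \<bar>f X - q X\<bar> \<le> \<alpha>) \<and> smooth_fun n \<beta> q"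

definition rfw_step :: "real \<Rightarrow> real \<Rightarrow> real" where
  "rfw_step \<beta> \<delta>h = min 1 (\<delta>h / (2 * \<beta>))"

text \<open>
  \<open>X\<close> is a possible run of the algorithm on \<open>q\<close>; iterates are numbered from 1 and the entry
  \<open>X 0\<close> is irrelevant.
\<close>

definition rfw_iterates ::
    "nat \<Rightarrow> (real mat \<Rightarrow> real) \<Rightarrow> real \<Rightarrow> real \<Rightarrow> (nat \<Rightarrow> real mat) \<Rightarrow> bool" where
  "rfw_iterates n q \<beta> \<delta>h X \<longleftrightarrow>
     (let \<eta> = rfw_step \<beta> \<delta>h in
      X 1 \<in> spectrahedron n \<and>
      (\<forall>t\<ge>1. \<exists>v.
         is_arg_min
           (\<lambda>w. inner_mat (outer_sq w) (grad n q (X t))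
                + \<eta> * \<beta> / 2 * (frob_norm (outer_sq w - X t))\<^sup>2)
           (\<lambda>w. w \<in> carrier_vec n \<and> l2_norm w = 1) v \<and>
         X (t + 1) = (1 - \<eta>) \<cdot>\<^sub>m X t + \<eta> \<cdot>\<^sub>m outer_sq v))"

lemma sym_mats_carrier: "A \<in> sym_mats n \<Longrightarrow> A \<in> carrier_mat n n"
  by (simp add: sym_mats_def)

lemma inner_mat_sum:
  assumes "A \<in> carrier_mat n n" "B \<in> carrier_mat n n"
  shows "inner_mat A B = (\<Sum>i<n. \<Sum>j<n. A $$ (j, i) * B $$ (j, i))"
  using assms unfolding inner_mat_def trace_mat_def
  by (auto simp: scalar_prod_def lessThan_atLeast0 intro!: sum.cong)

lemma is_gradient_unique:
  assumes G: "is_gradient n q X G" and G': "is_gradient n q X G'"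
  shows "G = G'"
proof -
  define D where "D = G - G'"
  have c: "G \<in> carrier_mat n n" "G' \<in> carrier_mat n n"
    and tr: "transpose_mat G = G" "transpose_mat G' = G'"
    using G G' by (auto simp: is_gradient_def sym_mats_def)
  have Dc: "D \<in> carrier_mat n n" using c by (auto simp: D_def)
  have "transpose_mat D = D"
    using c tr unfolding D_def by (simp add: transpose_minus)
  with Dc have Ds: "D \<in> sym_mats n" by (simp add: sym_mats_def)
  have sD: "s \<cdot>\<^sub>m D \<in> sym_mats n" for s
  proof -
    have "transpose_mat (s \<cdot>\<^sub>m D) = s \<cdot>\<^sub>m transpose_mat D"
      by (rule eq_matI) auto
    then show ?thesis using Ds by (simp add: sym_mats_def)
  qed
  have DD: "inner_mat D D = (\<Sum>i<n. \<Sum>j<n. (D $$ (j, i))\<^sup>2)"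
    using inner_mat_sum[OF Dc Dc] by (simp add: power2_eq_square)
  then have nn: "0 \<le> inner_mat D D" by (simp add: sum_nonneg)
  have ins: "inner_mat (s \<cdot>\<^sub>m D) B = s * inner_mat D B" if "B \<in> carrier_mat n n" for s B
    using Dc that by (simp add: inner_mat_sum[where n = n] sum_distrib_left mult.assoc)
  have diff: "inner_mat D G - inner_mat D G' = inner_mat D D"
    using c Dc by (simp add: inner_mat_sum[where n = n] sum_subtractf[symmetric] D_def
        right_diff_distrib)
  have insD: "inner_mat (s \<cdot>\<^sub>m D) (s \<cdot>\<^sub>m D) = s\<^sup>2 * inner_mat D D" for s
    using Dc by (simp add: inner_mat_sum[where n = n] sum_distrib_left power2_eq_square
        mult_ac)
  have fs: "frob_norm (s \<cdot>\<^sub>m D) = s * frob_norm D" if "s > 0" for s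
    using that by (simp add: frob_norm_def insD real_sqrt_mult)
  have fn: "0 \<le> frob_norm D" using nn by (simp add: frob_norm_def)
  have DDf: "inner_mat D D = frob_norm D * frob_norm D"
    using nn by (simp add: frob_norm_def)
  have "frob_norm D = 0"
  proof (rule ccontr)
    assume "frob_norm D \<noteq> 0"
    with fn have p: "frob_norm D > 0" by simp
    define e where "e = frob_norm D / 4"
    have e: "e > 0" using p by (simp add: e_def)
    obtain d1 where d1: "d1 > 0" "\<And>H. H \<in> sym_mats n \<Longrightarrow> frob_norm H < d1 \<Longrightarrow>
        \<bar>q (X + H) - q X - inner_mat H G\<bar> \<le> e * frob_norm H"
      using G e unfolding is_gradient_def by meson
    obtain d2 where d2: "d2 > 0" "\<And>H. H \<in> sym_mats n \<Longrightarrow> frob_norm H < d2 \<Longrightarrow>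
        \<bar>q (X + H) - q X - inner_mat H G'\<bar> \<le> e * frob_norm H"
      using G' e unfolding is_gradient_def by meson
    define s where "s = min d1 d2 / (2 * frob_norm D)"
    have s: "s > 0" using d1(1) d2(1) p by (simp add: s_def)
    have sf: "frob_norm (s \<cdot>\<^sub>m D) = min d1 d2 / 2"
      using fs[OF s] p by (simp add: s_def)
    have "\<bar>inner_mat (s \<cdot>\<^sub>m D) G - inner_mat (s \<cdot>\<^sub>m D) G'\<bar> \<le> 2 * e * frob_norm (s \<cdot>\<^sub>m D)"
    proof -
      have "frob_norm (s \<cdot>\<^sub>m D) < d1" "frob_norm (s \<cdot>\<^sub>m D) < d2"
        using sf d1(1) d2(1) by linarith+
      from d1(2)[OF sD this(1)] d2(2)[OF sD this(2)] show ?thesis by linarith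
    qed
    then have "s * (frob_norm D * frob_norm D) \<le> 2 * e * (s * frob_norm D)"
      using ins[OF c(1), of s] ins[OF c(2), of s] diff fs[OF s] DDf
      by (simp add: right_diff_distrib[symmetric])
    then have "s * frob_norm D * frob_norm D \<le> s * frob_norm D * (frob_norm D / 2)"
      by (simp add: e_def mult_ac)
    then have "frob_norm D \<le> frob_norm D / 2"
      using s p by (metis mult_pos_pos mult_le_cancel_left_pos)
    with p show False by simp
  qed
  then have "(\<Sum>i<n. \<Sum>j<n. (D $$ (j, i))\<^sup>2) = 0"
    using DDf DD by simp
  then have "D $$ (j, i) = 0" if "i < n" "j < n" for i j
    using that by (simp add: sum_nonneg_eq_0_iff sum_nonneg)
  then show ?thesis using c
    by (intro eq_matI) (auto simp: D_def)
qed

lemma grad_eq: "is_gradient n q X G \<Longrightarrow> grad n q X = G"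
  unfolding grad_def by (rule the_equality) (auto intro: is_gradient_unique)

end

theory Submission
  imports Defs
begin

text \<open>
  The eigenvalue gap makes \<open>X*\<close> a rank-one matrix \<open>u u\<^sup>T\<close>, with \<open>u\<close> a bottom eigenvector of
  \<open>G*\<close>, and gives the quadratic growth
  \<open>f X - f X* \<ge> \<langle>X - X*, G*\<rangle> \<ge> \<delta>/2 \<parallel>X - X*\<parallel>\<^sup>2\<close> on the spectrahedron. Since \<open>X*\<close> has rank one, it is
  a candidate in the subproblem of every step, so the descent lemma and convexity of the smooth
  approximation \<open>q\<close> yield
  \<open>q X\<^sub>t\<^sub>+\<^sub>1 \<le> q X\<^sub>t - \<eta> (q X\<^sub>t - q X*) + \<eta>\<^sup>2\<beta>/2 \<parallel>X\<^sub>t - X*\<parallel>\<^sup>2\<close>, and quadratic growth bounds the last term by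
  \<open>\<eta>/2 (q X\<^sub>t - q X* + 2\<alpha>)\<close>. Thus \<open>q X\<^sub>t - q X* - 2\<alpha>\<close> contracts by the factor \<open>1 - \<eta>/2\<close>, and
  \<open>C = 4\<close> works.
\<close>

section \<open>The trace inner product\<close>

lemma inner_mat_commute:
  assumes "A \<in> carrier_mat n n" "B \<in> carrier_mat n n"
  shows "inner_mat A B = inner_mat B A"
  using assms by (simp add: inner_mat_sum[where n = n] mult.commute)

lemma inner_mat_diff_left:
  assumes "A \<in> carrier_mat n n" "B \<in> carrier_mat n n" "C \<in> carrier_mat n n"
  shows "inner_mat (A - B) C = inner_mat A C - inner_mat B C"
  using assms
  by (simp add: inner_mat_sum[where n = n] minus_carrier_mat left_diff_distrib sum_subtractf)

lemma inner_mat_diff_right: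
  assumes "A \<in> carrier_mat n n" "B \<in> carrier_mat n n" "C \<in> carrier_mat n n"
  shows "inner_mat C (A - B) = inner_mat C A - inner_mat C B"
  using assms
  by (simp add: inner_mat_sum[where n = n] minus_carrier_mat right_diff_distrib sum_subtractf)

lemma inner_mat_smult_left:
  assumes "A \<in> carrier_mat n n" "B \<in> carrier_mat n n"
  shows "inner_mat (s \<cdot>\<^sub>m A) B = s * inner_mat A B"
  using assms by (simp add: inner_mat_sum[where n = n] sum_distrib_left mult.assoc)

lemma inner_mat_smult_right:
  assumes "A \<in> carrier_mat n n" "B \<in> carrier_mat n n"
  shows "inner_mat A (s \<cdot>\<^sub>m B) = s * inner_mat A B"
  using assms by (simp add: inner_mat_sum[where n = n] sum_distrib_left mult_ac)

lemma inner_mat_self_nonneg: "A \<in> carrier_mat n n \<Longrightarrow> 0 \<le> inner_mat A A"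
  by (simp add: inner_mat_sum[where n = n] sum_nonneg)

lemma frob_norm_nonneg: "A \<in> carrier_mat n n \<Longrightarrow> 0 \<le> frob_norm A"
  by (simp add: frob_norm_def inner_mat_self_nonneg)

lemma frob_norm_power2: "A \<in> carrier_mat n n \<Longrightarrow> (frob_norm A)\<^sup>2 = inner_mat A A"
  by (simp add: frob_norm_def inner_mat_self_nonneg)

lemma inner_mat_self_eq_0:
  assumes A: "A \<in> carrier_mat n n" and "inner_mat A A = 0"
  shows "A = 0\<^sub>m n n"
proof -
  have "A $$ (j, i) = 0" if "i < n" "j < n" for i j
    using assms that by (simp add: inner_mat_sum[OF A A] sum_nonneg_eq_0_iff sum_nonneg)
  then show ?thesis using A by (intro eq_matI) auto
qed

lemma frob_norm_smult:
  assumes "A \<in> carrier_mat n n"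
  shows "frob_norm (s \<cdot>\<^sub>m A) = \<bar>s\<bar> * frob_norm A"
  using assms
  by (simp add: frob_norm_def inner_mat_smult_left[where n = n] inner_mat_smult_right[where n = n]
      real_sqrt_mult flip: mult.assoc)

lemma frob_norm_diff_power2:
  assumes "A \<in> carrier_mat n n" "B \<in> carrier_mat n n"
  shows "(frob_norm (A - B))\<^sup>2 = (frob_norm A)\<^sup>2 + (frob_norm B)\<^sup>2 - 2 * inner_mat A B"
  using assms
  by (simp add: minus_carrier_mat frob_norm_power2[where n = n] inner_mat_diff_left[where n = n]
      inner_mat_diff_right[where n = n] inner_mat_commute[where n = n and A = B and B = A])

text \<open>Expand the nonnegative square of \<open>frob_norm (c A - b B)\<close> with
  \<open>b = inner_mat A B\<close> and \<open>c\<close> the squared norm of \<open>B\<close>.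
  Scaling \<open>A\<close> by \<open>c\<close> instead of dividing by it keeps the expansion
  polynomial; the positive factor \<open>c\<close> is cancelled only at the end.\<close>

lemma inner_mat_cauchy_schwarz:
  assumes A: "A \<in> carrier_mat n n" and B: "B \<in> carrier_mat n n"
  shows "\<bar>inner_mat A B\<bar> \<le> frob_norm A * frob_norm B"
proof (cases "frob_norm B = 0")
  case True
  then have "B = 0\<^sub>m n n"
    using frob_norm_power2[OF B] inner_mat_self_eq_0[OF B] by simp
  with A True show ?thesis by (simp add: inner_mat_sum[where n = n])
next
  case False
  define a b c where "a = frob_norm A" and "b = inner_mat A B" and "c = (frob_norm B)\<^sup>2"
  have c: "c > 0" using False by (simp add: c_def)
  have car: "c \<cdot>\<^sub>m A \<in> carrier_mat n n" "b \<cdot>\<^sub>m B \<in> carrier_mat n n" using A B by auto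
  have "0 \<le> (frob_norm (c \<cdot>\<^sub>m A - b \<cdot>\<^sub>m B))\<^sup>2" by simp
  also have "\<dots> = c\<^sup>2 * a\<^sup>2 + b\<^sup>2 * c - 2 * (c * (b * b))"
    unfolding frob_norm_diff_power2[OF car] using A B car
    by (simp add: frob_norm_smult[where n = n] power_mult_distrib
        inner_mat_smult_left[where n = n] inner_mat_smult_right[where n = n]
        flip: a_def b_def c_def)
  also have "\<dots> = c * (c * a\<^sup>2 - b\<^sup>2)" by (simp add: algebra_simps power2_eq_square)
  finally have "b\<^sup>2 \<le> c * a\<^sup>2" using c by (simp add: zero_le_mult_iff)
  then have "\<bar>b\<bar>\<^sup>2 \<le> (frob_norm A * frob_norm B)\<^sup>2"
    by (simp add: a_def c_def power_mult_distrib mult.commute)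
  then show ?thesis unfolding b_def
    by (rule power2_le_imp_le) (simp add: frob_norm_nonneg[OF A] frob_norm_nonneg[OF B])
qed

section \<open>Symmetric matrices, rank-one matrices and the spectrahedron\<close>

lemma sym_mats_index: "A \<in> sym_mats n \<Longrightarrow> i < n \<Longrightarrow> j < n \<Longrightarrow> A $$ (i, j) = A $$ (j, i)"
  unfolding sym_mats_def
  by (metis (mono_tags, lifting) carrier_matD index_transpose_mat(1) mem_Collect_eq)

lemma sym_mats_add: "A \<in> sym_mats n \<Longrightarrow> B \<in> sym_mats n \<Longrightarrow> A + B \<in> sym_mats n"
  by (auto simp: sym_mats_def transpose_add)

lemma sym_mats_diff: "A \<in> sym_mats n \<Longrightarrow> B \<in> sym_mats n \<Longrightarrow> A - B \<in> sym_mats n"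
  by (auto simp: sym_mats_def transpose_minus)

lemma sym_mats_smult: "A \<in> sym_mats n \<Longrightarrow> s \<cdot>\<^sub>m A \<in> sym_mats n"
  using sym_mats_index[of A n] by (auto simp: sym_mats_def intro!: eq_matI)

lemma outer_sq_sym: "v \<in> carrier_vec n \<Longrightarrow> outer_sq v \<in> sym_mats n"
  by (auto simp: outer_sq_def sym_mats_def mult.commute intro!: eq_matI)

lemma quad_form_sum:
  fixes A :: "real mat"
  assumes "A \<in> carrier_mat n n" "v \<in> carrier_vec n"
  shows "v \<bullet> (A *\<^sub>v v) = (\<Sum>i<n. \<Sum>j<n. A $$ (i, j) * (v $ i * v $ j))"
  using assms
  by (auto simp: scalar_prod_def sum_distrib_left lessThan_atLeast0 mult_ac intro!: sum.cong)

lemma inner_outer_sq: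
  assumes A: "A \<in> carrier_mat n n" and v: "v \<in> carrier_vec n"
  shows "inner_mat (outer_sq v) A = v \<bullet> (A *\<^sub>v v)"
proof -
  have c: "outer_sq v \<in> carrier_mat n n" using v by (auto simp: outer_sq_def)
  show ?thesis
    unfolding quad_form_sum[OF A v] inner_mat_sum[OF c A]
    by (subst sum.swap) (use v in \<open>auto simp: outer_sq_def mult_ac intro!: sum.cong\<close>)
qed

lemma outer_sq_mult_vec:
  assumes "v \<in> carrier_vec n" "w \<in> carrier_vec n"
  shows "outer_sq v *\<^sub>v w = (v \<bullet> w) \<cdot>\<^sub>v v"
  using assms by (intro eq_vecI) (auto simp: outer_sq_def scalar_prod_def sum_distrib_left mult_ac)

text \<open>The square of the left side is the quadratic form of \<open>outer_sq v\<close> at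
  \<open>v\<close> itself, which is the square of \<open>v \<bullet> v\<close>.\<close>

lemma frob_norm_outer_sq:
  assumes v: "v \<in> carrier_vec n"
  shows "frob_norm (outer_sq v) = v \<bullet> v"
proof -
  have "inner_mat (outer_sq v) (outer_sq v) = (v \<bullet> v)\<^sup>2"
    using v outer_sq_sym[OF v]
    by (simp add: inner_outer_sq[where n = n] sym_mats_carrier outer_sq_mult_vec[where n = n]
        power2_eq_square)
  then show ?thesis by (simp add: frob_norm_def scalar_prod_def sum_nonneg)
qed

lemma l2_norm_eq_1: "l2_norm v = 1 \<longleftrightarrow> v \<bullet> v = 1"
  by (simp add: l2_norm_def)

lemma outer_sq_spectrahedron:
  assumes v: "v \<in> carrier_vec n" and u: "v \<bullet> v = 1"
  shows "outer_sq v \<in> spectrahedron n"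
proof -
  have "trace_mat (outer_sq v) = 1"
    using u by (simp add: trace_mat_def outer_sq_def scalar_prod_def lessThan_atLeast0)
  moreover have "psd n (outer_sq v)"
    using v by (auto simp: psd_def outer_sq_mult_vec[where n = n]
        comm_scalar_prod[where n = n and v\<^sub>2 = v])
  ultimately show ?thesis using outer_sq_sym[OF v] by (simp add: spectrahedron_def)
qed

text \<open>Trace and quadratic form are linear in the matrix. This keeps the iterates
  feasible.\<close>

lemma spectrahedron_convex:
  assumes X: "X \<in> spectrahedron n" and Y: "Y \<in> spectrahedron n" and u: "0 \<le> u" "u \<le> 1"
  shows "(1 - u) \<cdot>\<^sub>m X + u \<cdot>\<^sub>m Y \<in> spectrahedron n"
proof -
  have c: "X \<in> carrier_mat n n" "Y \<in> carrier_mat n n"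
    using X Y by (auto simp: spectrahedron_def sym_mats_def)
  let ?Z = "(1 - u) \<cdot>\<^sub>m X + u \<cdot>\<^sub>m Y"
  have "?Z \<in> sym_mats n"
    using X Y by (simp add: spectrahedron_def sym_mats_add sym_mats_smult)
  moreover have "trace_mat ?Z = (1 - u) * trace_mat X + u * trace_mat Y"
    using c by (simp add: trace_mat_def sum.distrib sum_distrib_left)
  moreover have "0 \<le> v \<bullet> (?Z *\<^sub>v v)" if v: "v \<in> carrier_vec n" for v
  proof -
    have "?Z \<in> carrier_mat n n" using c by simp
    then have "v \<bullet> (?Z *\<^sub>v v) = (1 - u) * (v \<bullet> (X *\<^sub>v v)) + u * (v \<bullet> (Y *\<^sub>v v))"
      using c v by (simp add: quad_form_sum[where n = n] distrib_right sum.distrib sum_distrib_left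
          mult.assoc)
    then show ?thesis using X Y u v by (simp add: spectrahedron_def psd_def)
  qed
  ultimately show ?thesis using X Y by (simp add: spectrahedron_def psd_def)
qed

section \<open>Spectral decomposition of real symmetric matrices\<close>

lemma sym_mats_scalar_prod:
  assumes A: "A \<in> sym_mats n" and x: "x \<in> carrier_vec n" and y: "y \<in> carrier_vec n"
  shows "(A *\<^sub>v x) \<bullet> y = x \<bullet> (A *\<^sub>v y)"
  using transpose_vec_mult_scalar[of A n n y x] A x y by (simp add: sym_mats_def)

text \<open>Over the complex numbers the characteristic polynomial has a root \<open>z\<close>.
  Splitting an eigenvector into real and imaginary parts \<open>x\<close> and \<open>y\<close>,
  symmetry of \<open>A\<close> forces \<open>z\<close> to be real, so that whichever of
  \<open>x\<close>, \<open>y\<close> is nonzero is a real eigenvector for it.\<close>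

lemma sym_mats_unit_eigenvector:
  assumes A: "A \<in> sym_mats n" and n: "n > 0"
  shows "\<exists>e u. u \<in> carrier_vec n \<and> u \<bullet> u = 1 \<and> A *\<^sub>v u = e \<cdot>\<^sub>v u"
proof -
  have Ac: "A \<in> carrier_mat n n" using A by (simp add: sym_mats_def)
  let ?C = "map_mat complex_of_real A"
  have C: "?C \<in> carrier_mat n n" using Ac by simp
  obtain as where as: "char_poly ?C = (\<Prod>a\<leftarrow>as. [:- a, 1:])" "length as = n"
    using char_poly_factorized[OF C] by blast
  then obtain z as' where "as = z # as'" using n by (cases as) auto
  then have "eigenvalue ?C z" using as(1) by (simp add: eigenvalue_root_char_poly[OF C])
  then obtain v where v: "v \<in> carrier_vec n" "v \<noteq> 0\<^sub>v n" "?C *\<^sub>v v = z \<cdot>\<^sub>v v"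
    using C by (auto simp: eigenvalue_def eigenvector_def)
  define x y where "x = map_vec Re v" and "y = map_vec Im v"
  have xy: "x \<in> carrier_vec n" "y \<in> carrier_vec n" using v(1) by (auto simp: x_def y_def)
  have ev: "(\<Sum>j<n. complex_of_real (A $$ (i, j)) * v $ j) = z * v $ i" if i: "i < n" for i
    using arg_cong[OF v(3), of "\<lambda>w. w $ i"] i Ac v(1)
    by (simp add: scalar_prod_def lessThan_atLeast0)
  have Ax: "A *\<^sub>v x = Re z \<cdot>\<^sub>v x - Im z \<cdot>\<^sub>v y"
  proof (rule eq_vecI)
    fix i assume "i < dim_vec (Re z \<cdot>\<^sub>v x - Im z \<cdot>\<^sub>v y)"
    then have i: "i < n" using xy by simp
    show "(A *\<^sub>v x) $ i = (Re z \<cdot>\<^sub>v x - Im z \<cdot>\<^sub>v y) $ i"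
      using arg_cong[OF ev[OF i], of Re] i Ac v(1)
      by (simp add: scalar_prod_def lessThan_atLeast0 x_def y_def)
  qed (use Ac xy in auto)
  have Ay: "A *\<^sub>v y = Im z \<cdot>\<^sub>v x + Re z \<cdot>\<^sub>v y"
  proof (rule eq_vecI)
    fix i assume "i < dim_vec (Im z \<cdot>\<^sub>v x + Re z \<cdot>\<^sub>v y)"
    then have i: "i < n" using xy by simp
    show "(A *\<^sub>v y) $ i = (Im z \<cdot>\<^sub>v x + Re z \<cdot>\<^sub>v y) $ i"
      using arg_cong[OF ev[OF i], of Im] i Ac v(1)
      by (simp add: scalar_prod_def lessThan_atLeast0 x_def y_def)
  qed (use Ac xy in auto)
  have pos: "w \<bullet> w > 0" if w: "w \<in> carrier_vec n" "w \<noteq> 0\<^sub>v n" for w :: "real vec"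
  proof -
    obtain i where i: "i < n" "w $ i \<noteq> 0"
      using w by (metis carrier_vecD eq_vecI index_zero_vec)
    then have "0 < (\<Sum>j = 0..<n. w $ j * w $ j)"
      by (intro sum_pos2[of _ i]) (auto simp: zero_less_mult_iff neq_iff)
    then show ?thesis using w by (simp add: scalar_prod_def)
  qed
  have nonneg: "w \<bullet> w \<ge> 0" for w :: "real vec" by (simp add: scalar_prod_def sum_nonneg)
  have nz: "x \<noteq> 0\<^sub>v n \<or> y \<noteq> 0\<^sub>v n"
  proof (rule ccontr)
    assume *: "\<not> ?thesis"
    have "v $ i = 0" if "i < n" for i
    proof -
      have "x $ i = 0" "y $ i = 0" using * that by auto
      then show ?thesis using that v(1) by (simp add: x_def y_def complex_eq_iff)
    qed
    then have "v = 0\<^sub>v n" using v(1) by (intro eq_vecI) auto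
    with v(2) show False by simp
  qed
  \<comment> \<open>Substituting \<open>Ax\<close> and \<open>Ay\<close>, the terms in
    \<open>Re z\<close> cancel and only \<open>Im z\<close> times the squared length of the complex
    eigenvector remains.\<close>
  have "(A *\<^sub>v x) \<bullet> y = x \<bullet> (A *\<^sub>v y)" by (rule sym_mats_scalar_prod[OF A xy])
  then have "Im z * (x \<bullet> x + y \<bullet> y) = 0"
    using xy unfolding Ax Ay
    by (simp add: minus_scalar_prod_distrib[where n = n] scalar_prod_add_distrib[where n = n]
        algebra_simps)
  moreover have "x \<bullet> x + y \<bullet> y > 0"
    using nz pos[OF xy(1)] pos[OF xy(2)] nonneg[of x] nonneg[of y] by linarith
  ultimately have Im: "Im z = 0" by simp
  have Ax': "A *\<^sub>v x = Re z \<cdot>\<^sub>v x" and Ay': "A *\<^sub>v y = Re z \<cdot>\<^sub>v y"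
    unfolding Ax Ay using xy by (auto simp: Im intro!: eq_vecI)
  obtain w where w: "w \<in> carrier_vec n" "w \<noteq> 0\<^sub>v n" "A *\<^sub>v w = Re z \<cdot>\<^sub>v w"
  proof (cases "x = 0\<^sub>v n")
    case False
    then show ?thesis using that[of x] xy Ax' by auto
  next
    case True
    then show ?thesis using that[of y] nz xy Ay' by auto
  qed
  define u where "u = (1 / sqrt (w \<bullet> w)) \<cdot>\<^sub>v w"
  have "u \<in> carrier_vec n" "u \<bullet> u = 1" using w(1) pos[OF w(1,2)] by (auto simp: u_def)
  moreover have "A *\<^sub>v u = Re z \<cdot>\<^sub>v u"
    unfolding u_def mult_mat_vec[OF Ac w(1)] w(3) by (rule eq_vecI) auto
  ultimately show ?thesis by blast
qed

text \<open>The reflection along the difference \<omega> of the first unit vector and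
  \<open>u\<close> exchanges these two vectors of equal length. It supplies an orthogonal matrix
  with prescribed first column without completing \<open>u\<close> to an orthonormal basis.\<close>

lemma householder_reflection:
  fixes u :: "real vec"
  assumes u: "u \<in> carrier_vec n" "u \<bullet> u = 1" and n: "n > 0"
  shows "\<exists>P. P \<in> sym_mats n \<and> P * P = 1\<^sub>m n \<and> col P 0 = u"
proof -
  define \<omega> where "\<omega> i = (if i = 0 then 1 else 0) - u $ i" for i
  define S where "S = (\<Sum>k<n. \<omega> k * \<omega> k)"
  \<comment> \<open>If \<open>u\<close> is the first unit vector, then \<open>S = 0\<close>, hence \<open>c = 0\<close> and the reflection
    degenerates to the identity.\<close>
  define c where "c = 2 / S"
  define P where "P = mat n n (\<lambda>(i, j). (if i = j then 1 else 0) - c * \<omega> i * \<omega> j)"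
  have zero: "\<omega> i = 0" if "S = 0" "i < n" for i
    using that by (simp add: S_def sum_nonneg_eq_0_iff)
  \<comment> \<open>Since \<open>u\<close> has length one, the squared length of \<omega> is twice
    its first entry. This is what makes the first column of \<open>P\<close> equal to
    \<open>u\<close>.\<close>
  have "S = (\<Sum>k<n. (if k = 0 then 1 - 2 * u $ 0 else 0) + u $ k * u $ k)"
    unfolding S_def \<omega>_def by (intro sum.cong) (auto simp: algebra_simps)
  also have "\<dots> = 2 * \<omega> 0"
    using u n by (simp add: sum.distrib scalar_prod_def lessThan_atLeast0 \<omega>_def)
  finally have S: "S = 2 * \<omega> 0" .
  have "col P 0 = u"
  proof (rule eq_vecI)
    fix i assume "i < dim_vec u"
    then have i: "i < n" using u by simp
    have "c * \<omega> i * \<omega> 0 = \<omega> i"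
      using zero[OF _ i] S by (cases "S = 0") (auto simp: c_def)
    moreover have "col P 0 $ i = (if i = 0 then 1 else 0) - c * \<omega> i * \<omega> 0"
      using i n by (simp add: P_def)
    ultimately show "col P 0 $ i = u $ i" using \<omega>_def[of i] by linarith
  qed (use u in \<open>simp add: P_def\<close>)
  moreover have "P \<in> sym_mats n"
    by (auto simp: P_def sym_mats_def intro!: eq_matI)
  moreover have "P * P = 1\<^sub>m n"
  proof (rule eq_matI)
    fix i j assume "i < dim_row (1\<^sub>m n :: real mat)" "j < dim_col (1\<^sub>m n :: real mat)"
    then have ij: "i < n" "j < n" by auto
    have "(P * P) $$ (i, j) = (\<Sum>k<n. ((if i = k then 1 else 0) - c * \<omega> i * \<omega> k)
        * ((if k = j then 1 else 0) - c * \<omega> k * \<omega> j))"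
      using ij by (simp add: P_def scalar_prod_def lessThan_atLeast0)
    also have "\<dots> = (\<Sum>k<n. (if k = i then (if i = j then 1 else 0) - c * \<omega> i * \<omega> j else 0)
        - (if k = j then c * \<omega> i * \<omega> j else 0) + c * c * \<omega> i * \<omega> j * (\<omega> k * \<omega> k))"
      by (intro sum.cong) (auto simp: algebra_simps)
    also have "\<dots> = (if i = j then 1 else 0) - 2 * (c * \<omega> i * \<omega> j) + c * c * \<omega> i * \<omega> j * S"
      using ij by (simp add: sum.distrib sum_subtractf S_def flip: sum_distrib_left)
    also have "c * c * \<omega> i * \<omega> j * S = 2 * (c * \<omega> i * \<omega> j)"
      by (cases "S = 0") (auto simp: c_def)
    finally show "(P * P) $$ (i, j) = 1\<^sub>m n $$ (i, j)" using ij by simp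
  qed (auto simp: P_def)
  ultimately show ?thesis by blast
qed

lemma sym_mats_congruence:
  assumes A: "A \<in> sym_mats n" and P: "P \<in> carrier_mat n n"
  shows "transpose_mat P * A * P \<in> sym_mats n"
proof -
  have Ac: "A \<in> carrier_mat n n" and AT: "transpose_mat A = A" using A by (auto simp: sym_mats_def)
  have PT: "transpose_mat P \<in> carrier_mat n n" using P by simp
  have "transpose_mat (transpose_mat P * A * P)
      = transpose_mat P * (transpose_mat A * transpose_mat (transpose_mat P))"
    by (simp only: transpose_mult[OF mult_carrier_mat[OF PT Ac] P] transpose_mult[OF PT Ac])
  then show ?thesis using Ac P PT by (simp add: sym_mats_def AT assoc_mult_mat[OF PT Ac P])
qed

text \<open>Induction on the dimension. Conjugation by a Householder reflection moves a unit
  eigenvector to the first coordinate. The first column of the result is then \<open>e\<close> times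
  the first unit vector and, by symmetry, so is the first row; the induction hypothesis diagonalizes
  the remaining block \<open>B\<close>.\<close>

lemma sym_mats_orthogonal_diagonalization:
  assumes "A \<in> sym_mats n"
  shows "\<exists>P D. P \<in> carrier_mat n n \<and> D \<in> carrier_mat n n \<and> P * transpose_mat P = 1\<^sub>m n
    \<and> diagonal_mat D \<and> A = P * D * transpose_mat P"
  using assms
proof (induction n arbitrary: A)
  case 0
  then show ?case
    by (intro exI[of _ "1\<^sub>m 0"]) (auto simp: sym_mats_def diagonal_mat_def intro!: eq_matI)
next
  case (Suc m)
  let ?n = "Suc m"
  have Ac: "A \<in> carrier_mat ?n ?n" using Suc.prems by (simp add: sym_mats_def)
  obtain e u where u: "u \<in> carrier_vec ?n" "u \<bullet> u = 1" "A *\<^sub>v u = e \<cdot>\<^sub>v u"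
    using sym_mats_unit_eigenvector[OF Suc.prems] by auto
  obtain P where Ps: "P \<in> sym_mats ?n" and PP: "P * P = 1\<^sub>m ?n" and P0: "col P 0 = u"
    using householder_reflection[OF u(1,2)] by auto
  have Pc: "P \<in> carrier_mat ?n ?n" and PT: "transpose_mat P = P"
    using Ps by (auto simp: sym_mats_def)
  define A' where "A' = P * A * P"
  have A's: "A' \<in> sym_mats ?n"
    using sym_mats_congruence[OF Suc.prems Pc] by (simp add: A'_def PT)
  then have A'c: "A' \<in> carrier_mat ?n ?n" by (simp add: sym_mats_def)
  have "col A' 0 = P *\<^sub>v (A *\<^sub>v u)"
    unfolding A'_def assoc_mult_mat[OF Pc Ac Pc]
    by (simp only: col_mult2[OF Pc mult_carrier_mat[OF Ac Pc]] col_mult2[OF Ac Pc] P0 zero_less_Suc)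
  also have "\<dots> = e \<cdot>\<^sub>v (P *\<^sub>v col P 0)"
    using Pc u P0 by (simp add: mult_mat_vec[where nr = ?n and nc = ?n])
  also have "P *\<^sub>v col P 0 = col (1\<^sub>m ?n) 0"
    unfolding PP[symmetric] by (rule col_mult2[OF Pc Pc zero_less_Suc, symmetric])
  finally have col0: "col A' 0 = e \<cdot>\<^sub>v unit_vec ?n 0" by simp
  have A'i0: "A' $$ (i, 0) = (if i = 0 then e else 0)" if "i < ?n" for i
    using arg_cong[OF col0, of "\<lambda>v. v $ i"] that A'c by simp
  define B where "B = mat m m (\<lambda>(i, j). A' $$ (Suc i, Suc j))"
  define E where "E = mat 1 1 (\<lambda>_. e)"
  have Bs: "B \<in> sym_mats m"
    using sym_mats_index[OF A's] by (auto simp: B_def sym_mats_def intro!: eq_matI)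
  obtain Q D where Q: "Q \<in> carrier_mat m m" and D: "D \<in> carrier_mat m m"
    and QQ: "Q * transpose_mat Q = 1\<^sub>m m" and dD: "diagonal_mat D"
    and BQ: "B = Q * D * transpose_mat Q"
    using Suc.IH[OF Bs] by blast
  \<comment> \<open>Block-diagonal matrices multiply block by block, so the factorization of
    \<open>B\<close> lifts to one of \<open>A'\<close> with \<open>R\<close> as the orthogonal
    factor.\<close>
  let ?f = "\<lambda>X Y :: real mat. four_block_mat X (0\<^sub>m 1 m) (0\<^sub>m m 1) Y"
  have mult: "?f X Y * ?f X' Y' = ?f (X * X') (Y * Y')"
    if "X \<in> carrier_mat 1 1" "X' \<in> carrier_mat 1 1" "Y \<in> carrier_mat m m" "Y' \<in> carrier_mat m m"
    for X X' Y Y'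
    using that by (subst mult_four_block_mat) auto
  have car: "?f X Y \<in> carrier_mat ?n ?n"
    if "X \<in> carrier_mat 1 1" "Y \<in> carrier_mat m m" for X Y
    using four_block_carrier_mat[OF that] by simp
  have E: "E \<in> carrier_mat 1 1" by (simp add: E_def)
  define R where "R = ?f (1\<^sub>m 1) Q"
  have Rc: "R \<in> carrier_mat ?n ?n" unfolding R_def by (rule car) (use Q in auto)
  have RT: "transpose_mat R = ?f (1\<^sub>m 1) (transpose_mat Q)"
    unfolding R_def using Q by (subst transpose_four_block_mat) auto
  have RR: "R * transpose_mat R = 1\<^sub>m ?n"
    unfolding RT unfolding R_def using Q by (subst mult) (auto simp: QQ)
  have A'R: "A' = R * ?f E D * transpose_mat R"
  proof -
    have "R * ?f E D * transpose_mat R = ?f E B"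
    proof -
      have "R * ?f E D = ?f E (Q * D)"
        unfolding R_def using Q D E by (subst mult) auto
      also have "\<dots> * transpose_mat R = ?f E B"
        unfolding RT BQ using Q D E by (subst mult) auto
      finally show ?thesis .
    qed
    \<comment> \<open>The zero first column of \<open>A'\<close> below the corner is
      \<open>A'i0\<close>; the zero first row follows from it by symmetry.\<close>
    also have "\<dots> = A'"
    proof (rule eq_matI)
      fix i j assume "i < dim_row A'" "j < dim_col A'"
      then have "i < ?n" "j < ?n" using A'c by auto
      then show "?f E B $$ (i, j) = A' $$ (i, j)"
        using A'i0 sym_mats_index[OF A's, of 0 j]
        by (cases i; cases j) (auto simp: E_def B_def)
    qed (use A'c in \<open>auto simp: E_def B_def\<close>)
    finally show ?thesis by simp
  qed
  note assoc = assoc_mult_mat[where n\<^sub>1 = ?n and n\<^sub>2 = ?n and n\<^sub>3 = ?n and n\<^sub>4 = ?n]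
  have DE: "?f E D \<in> carrier_mat ?n ?n" by (rule car[OF E D])
  have PRT: "transpose_mat (P * R) = transpose_mat R * P"
    using Pc Rc by (simp add: transpose_mult[where nr = ?n and n = ?n and nc = ?n] PT)
  have "A = (P * P) * A * (P * P)" using Ac unfolding PP by simp
  also have "\<dots> = P * A' * P" unfolding A'_def using Ac Pc by (simp add: assoc)
  also have "\<dots> = (P * R) * ?f E D * transpose_mat (P * R)"
    unfolding A'R PRT using Pc Rc DE by (simp add: assoc)
  finally have 1: "A = (P * R) * ?f E D * transpose_mat (P * R)" .
  have "(P * R) * transpose_mat (P * R) = P * (R * transpose_mat R) * P"
    unfolding PRT using Pc Rc by (simp add: assoc)
  also have "\<dots> = 1\<^sub>m ?n" unfolding RR using Pc PP by simp
  finally have 2: "(P * R) * transpose_mat (P * R) = 1\<^sub>m ?n" .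
  have 3: "diagonal_mat (?f E D)"
    using dD D E by (auto simp: diagonal_mat_def)
  show ?case
    by (rule exI[of _ "P * R"], rule exI[of _ "?f E D"])
      (intro conjI 1 2 3 DE mult_carrier_mat[OF Pc Rc])
qed

text \<open>The columns of the diagonalizing matrix are orthonormal eigenvectors. The spectral
  theorem is put in terms of the weights \<open>U i \<bullet> (X *\<^sub>v U i)\<close>: for
  \<open>X\<close> in the spectrahedron they are nonnegative with sum 1, so
  \<open>inner_mat X A\<close> is an average of eigenvalues. The values \<open>d\<close> are
  unordered; the characteristic polynomial ties them to \<open>eigval\<close>.\<close>

lemma sym_mats_spectral:
  assumes A: "A \<in> sym_mats n"
  obtains U :: "nat \<Rightarrow> real vec" and d :: "nat \<Rightarrow> real" where
    "\<And>i. i < n \<Longrightarrow> U i \<in> carrier_vec n"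
    "\<And>i. i < n \<Longrightarrow> U i \<bullet> U i = 1"
    "\<And>i. i < n \<Longrightarrow> U i \<bullet> (A *\<^sub>v U i) = d i"
    "\<And>X. X \<in> carrier_mat n n \<Longrightarrow> (\<Sum>i<n. U i \<bullet> (X *\<^sub>v U i)) = trace_mat X"
    "\<And>X. X \<in> carrier_mat n n \<Longrightarrow> inner_mat X A = (\<Sum>i<n. d i * (U i \<bullet> (X *\<^sub>v U i)))"
    "char_poly A = (\<Prod>a\<leftarrow>map d [0..<n]. [:- a, 1:])"
proof -
  have Ac: "A \<in> carrier_mat n n" using A by (simp add: sym_mats_def)
  obtain P D where P: "P \<in> carrier_mat n n" and D: "D \<in> carrier_mat n n"
    and PP: "P * transpose_mat P = 1\<^sub>m n" and dD: "diagonal_mat D"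
    and APD: "A = P * D * transpose_mat P"
    using sym_mats_orthogonal_diagonalization[OF A] by blast
  have PTc: "transpose_mat P \<in> carrier_mat n n" using P by simp
  have PP': "transpose_mat P * P = 1\<^sub>m n" by (rule mat_mult_left_right_inverse[OF P PTc PP])
  note assoc = assoc_mult_mat[where n\<^sub>1 = n and n\<^sub>2 = n and n\<^sub>3 = n and n\<^sub>4 = n]
  have "transpose_mat P * (A * P) = (transpose_mat P * P) * D * (transpose_mat P * P)"
    unfolding APD using P D by (simp add: assoc)
  then have PAP: "transpose_mat P * (A * P) = D" unfolding PP' using D by simp
  define d where "d i = D $$ (i, i)" for i
  define U where "U i = col P i" for i
  have U: "U i \<in> carrier_vec n" if "i < n" for i using P by (auto simp: U_def)
  have Ui: "U k $ a = P $$ (a, k)" if "k < n" "a < n" for k a using that P by (simp add: U_def)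
  have UU: "U i \<bullet> U i = 1" if "i < n" for i
    using arg_cong[OF PP', of "\<lambda>M. M $$ (i, i)"] that P by (simp add: U_def)
  have UA: "U i \<bullet> (A *\<^sub>v U i) = d i" if "i < n" for i
  proof -
    have "D $$ (i, i) = (transpose_mat P * (A * P)) $$ (i, i)" by (simp add: PAP)
    also have "\<dots> = col P i \<bullet> (A *\<^sub>v col P i)"
      using that P Ac by (simp add: col_mult2[OF Ac P that])
    finally show ?thesis by (simp add: d_def U_def)
  qed
  \<comment> \<open>Orthonormality of the rows of \<open>P\<close>, that is, completeness of the
    vectors \<open>U k\<close>.\<close>
  have delta: "(\<Sum>k<n. P $$ (a, k) * P $$ (b, k)) = (if a = b then 1 else 0)"
    if "a < n" "b < n" for a b
    using arg_cong[OF PP, of "\<lambda>M. M $$ (a, b)"] that P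
    by (simp add: scalar_prod_def lessThan_atLeast0)
  have Aab: "A $$ (a, b) = (\<Sum>k<n. d k * (P $$ (a, k) * P $$ (b, k)))" if ab: "a < n" "b < n" for a b
  proof -
    have PD: "(P * D) $$ (a, k) = P $$ (a, k) * d k" if k: "k < n" for k
    proof -
      have "(P * D) $$ (a, k) = (\<Sum>l<n. P $$ (a, l) * D $$ (l, k))"
        using ab k P D by (simp add: scalar_prod_def lessThan_atLeast0)
      also have "\<dots> = (\<Sum>l<n. if l = k then P $$ (a, k) * d k else 0)"
        using dD D k by (intro sum.cong) (auto simp: diagonal_mat_def d_def)
      finally show ?thesis using k by simp
    qed
    have "A $$ (a, b) = (\<Sum>k<n. (P * D) $$ (a, k) * P $$ (b, k))"
      unfolding APD using ab P D
      by (simp add: scalar_prod_def lessThan_atLeast0 del: assoc_mult_mat)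
    also have "\<dots> = (\<Sum>k<n. d k * (P $$ (a, k) * P $$ (b, k)))"
      by (intro sum.cong) (auto simp: PD)
    finally show ?thesis .
  qed
  \<comment> \<open>One exchange of sums serves twice: \<open>c = 1\<close> gives the trace by
    \<open>delta\<close>, and \<open>c = d\<close> gives the inner product with \<open>A\<close> by
    \<open>Aab\<close>.\<close>
  have weighted: "(\<Sum>k<n. c k * (U k \<bullet> (X *\<^sub>v U k)))
      = (\<Sum>a<n. \<Sum>b<n. X $$ (a, b) * (\<Sum>k<n. c k * (P $$ (a, k) * P $$ (b, k))))"
    if X: "X \<in> carrier_mat n n" for X and c :: "nat \<Rightarrow> real"
  proof -
    have "(\<Sum>k<n. c k * (U k \<bullet> (X *\<^sub>v U k)))
        = (\<Sum>k<n. \<Sum>a<n. \<Sum>b<n. X $$ (a, b) * (c k * (P $$ (a, k) * P $$ (b, k))))"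
    proof (intro sum.cong refl)
      fix k assume "k \<in> {..<n}"
      then have k: "k < n" by simp
      have "U k \<bullet> (X *\<^sub>v U k) = (\<Sum>a<n. \<Sum>b<n. X $$ (a, b) * (P $$ (a, k) * P $$ (b, k)))"
        unfolding quad_form_sum[OF X U[OF k]] by (intro sum.cong refl) (simp add: Ui[OF k])
      then show "c k * (U k \<bullet> (X *\<^sub>v U k))
          = (\<Sum>a<n. \<Sum>b<n. X $$ (a, b) * (c k * (P $$ (a, k) * P $$ (b, k))))"
        by (simp add: sum_distrib_left mult.left_commute)
    qed
    also have "\<dots> = (\<Sum>a<n. \<Sum>k<n. \<Sum>b<n. X $$ (a, b) * (c k * (P $$ (a, k) * P $$ (b, k))))"
      by (rule sum.swap)
    also have "\<dots> = (\<Sum>a<n. \<Sum>b<n. \<Sum>k<n. X $$ (a, b) * (c k * (P $$ (a, k) * P $$ (b, k))))"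
      by (intro sum.cong refl sum.swap)
    finally show ?thesis by (simp add: sum_distrib_left)
  qed
  have tr: "(\<Sum>i<n. U i \<bullet> (X *\<^sub>v U i)) = trace_mat X" if X: "X \<in> carrier_mat n n" for X
  proof -
    have "(\<Sum>i<n. U i \<bullet> (X *\<^sub>v U i)) = (\<Sum>a<n. \<Sum>b<n. if b = a then X $$ (a, a) else 0)"
      unfolding weighted[OF X, of "\<lambda>_. 1", simplified] by (intro sum.cong refl) (simp add: delta)
    then show ?thesis using X by (simp add: trace_mat_def)
  qed
  have inn: "inner_mat X A = (\<Sum>i<n. d i * (U i \<bullet> (X *\<^sub>v U i)))" if X: "X \<in> carrier_mat n n" for X
    unfolding weighted[OF X] inner_mat_sum[OF X Ac]
    by (subst sum.swap, intro sum.cong refl) (simp add: Aab)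
  have "similar_mat A D"
    using Ac P D by (intro similar_matI[OF _ PP PP' APD]) auto
  then have "char_poly A = char_poly D" by (rule char_poly_similar)
  also have "\<dots> = (\<Prod>a\<leftarrow>diag_mat D. [:- a, 1:])"
    using dD D by (intro char_poly_upper_triangular[OF D])
      (auto simp: diagonal_mat_def upper_triangular_def)
  also have "diag_mat D = map d [0..<n]" using D by (simp add: diag_mat_def d_def)
  finally have cp: "char_poly A = (\<Prod>a\<leftarrow>map d [0..<n]. [:- a, 1:])" .
  show thesis by (rule that[OF U UU UA tr inn cp])
qed

section \<open>Eigenvalue gap and quadratic growth\<close>

lemma proots_prod_linear: "proots (\<Prod>a\<leftarrow>xs. [:- a, 1:]) = mset (xs :: real list)"
proof (induction xs)
  case (Cons a xs)
  have "(\<Prod>a\<leftarrow>xs. [:- a, 1:]) \<noteq> 0" by (auto simp: prod_list_zero_iff)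
  then have "proots ([:- a, 1:] * (\<Prod>a\<leftarrow>xs. [:- a, 1:])) = proots [:- a, 1:] + mset xs"
    by (subst proots_mult) (auto simp: Cons.IH)
  then show ?case by simp
qed simp

text \<open>Sorting \<open>d\<close> in ascending order puts the two smallest eigenvalues
  \<open>a\<close> and \<open>b\<close> in front. Discarding one index \<open>k\<close> that carries
  \<open>a\<close> leaves a multiset with minimum \<open>b\<close>.\<close>

lemma eigval_simple_minimum:
  assumes cp: "char_poly A = (\<Prod>a\<leftarrow>map d [0..<n]. [:- a, 1:])" and n: "n \<ge> 2"
  obtains k where "k < n" "d k = eigval n A" "\<And>i. i < n \<Longrightarrow> i \<noteq> k \<Longrightarrow> eigval (n - 1) A \<le> d i"
proof -
  define xs where "xs = sort (map d [0..<n])"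
  have ev: "eigvals_desc A = rev xs"
    unfolding eigvals_desc_def cp proots_prod_linear xs_def
    by (simp only: sorted_list_of_multiset_mset)
  have len: "length xs = n" by (simp add: xs_def)
  with n obtain a b ys where xs: "xs = a # b # ys"
    by (metis One_nat_def Suc_1 Suc_le_length_iff)
  \<comment> \<open>\<open>eigval\<close> counts from 1 in descending order, so its indices
    \<open>n\<close> and \<open>n - 1\<close> are the positions 0 and 1 of the ascending list
    \<open>xs\<close>.\<close>
  have last: "eigval n A = a" "eigval (n - 1) A = b"
    using n len rev_nth[of "n - 1" xs] rev_nth[of "n - 1 - 1" xs]
    by (simp_all add: eigval_def ev xs)
  \<comment> \<open>Comparing multisets rather than sets removes exactly one copy of
    \<open>a\<close>, which stays correct when \<open>a\<close> occurs repeatedly.\<close>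
  have m: "image_mset d (mset_set {..<n}) = mset xs"
    unfolding xs_def by (simp add: lessThan_atLeast0)
  then have "a \<in># image_mset d (mset_set {..<n})" by (simp add: xs)
  then obtain k where k: "k < n" "d k = a" by auto
  have "{..<n} = insert k ({..<n} - {k})" using k by auto
  then have "mset_set {..<n} = add_mset k (mset_set ({..<n} - {k}))"
    by (metis finite_Diff finite_lessThan insert_Diff_single mset_set.insert Diff_iff singletonI)
  with m have rest: "image_mset d (mset_set ({..<n} - {k})) = mset (b # ys)"
    using k by (simp add: xs)
  have srt: "sorted (b # ys)"
    using sorted_sort[of "map d [0..<n]"] unfolding xs_def[symmetric] xs by simp
  have "b \<le> d i" if "i < n" "i \<noteq> k" for i
  proof -
    have "d i \<in># image_mset d (mset_set ({..<n} - {k}))" using that by auto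
    then have "d i \<in> set (b # ys)" unfolding rest by (simp only: set_mset_mset)
    then show ?thesis using srt by auto
  qed
  then show thesis using that k last by metis
qed

section \<open>Distances in the spectrahedron and growth from the eigenvalue gap\<close>

lemma spectrahedron_sym: "X \<in> spectrahedron n \<Longrightarrow> X \<in> sym_mats n"
  by (simp add: spectrahedron_def)

text \<open>Here the spectral lemma is applied to \<open>X\<close> itself: its eigenvalues lie in
  [0, 1] and sum to 1, so the sum of their squares is at most 1.\<close>

lemma frob_norm_spectrahedron:
  assumes X: "X \<in> spectrahedron n"
  shows "(frob_norm X)\<^sup>2 \<le> 1"
proof -
  have Xs: "X \<in> sym_mats n" and Xc: "X \<in> carrier_mat n n" and tr: "trace_mat X = 1" and psd: "psd n X"
    using X by (auto simp: spectrahedron_def sym_mats_def)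
  obtain U :: "nat \<Rightarrow> real vec" and d where U: "\<And>i. i < n \<Longrightarrow> U i \<in> carrier_vec n"
    and UX: "\<And>i. i < n \<Longrightarrow> U i \<bullet> (X *\<^sub>v U i) = d i"
    and trU: "\<And>X. X \<in> carrier_mat n n \<Longrightarrow> (\<Sum>i<n. U i \<bullet> (X *\<^sub>v U i)) = trace_mat X"
    and inn: "\<And>Y. Y \<in> carrier_mat n n \<Longrightarrow> inner_mat Y X = (\<Sum>i<n. d i * (U i \<bullet> (Y *\<^sub>v U i)))"
    by (rule sym_mats_spectral[OF Xs], rule that) assumption+
  have d0: "0 \<le> d i" if "i < n" for i
    using psd U[OF that] UX[OF that] by (auto simp: psd_def)
  have sd: "(\<Sum>i<n. d i) = 1" using trU[OF Xc] UX tr by simp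
  have d1: "d i \<le> 1" if "i < n" for i
    using member_le_sum[of i "{..<n}" d] d0 that sd by simp
  have "(frob_norm X)\<^sup>2 = (\<Sum>i<n. d i * d i)"
    unfolding frob_norm_power2[OF Xc] inn[OF Xc] using UX by simp
  also have "\<dots> \<le> (\<Sum>i<n. d i)"
    by (intro sum_mono mult_left_le) (use d0 d1 in auto)
  finally show ?thesis using sd by simp
qed

lemma frob_norm_diff_outer_sq:
  assumes X: "X \<in> spectrahedron n" and u: "u \<in> carrier_vec n" "u \<bullet> u = 1"
  shows "(frob_norm (X - outer_sq u))\<^sup>2 \<le> 2 * (1 - u \<bullet> (X *\<^sub>v u))"
proof -
  have c: "X \<in> carrier_mat n n" "outer_sq u \<in> carrier_mat n n"
    using spectrahedron_sym[OF X] outer_sq_sym[OF u(1)] by (auto simp: sym_mats_def)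
  show ?thesis
    using frob_norm_spectrahedron[OF X] u
    by (simp add: frob_norm_diff_power2[OF c] frob_norm_outer_sq inner_mat_commute[OF c]
        inner_outer_sq[OF c(1)])
qed

text \<open>Growth is first shown around \<open>V\<close>, the projector onto a bottom eigenvector:
  any weight that \<open>X\<close> puts off that eigenvector costs at least \<delta>, while
  \<open>frob_norm_diff_outer_sq\<close> bounds the squared distance to \<open>V\<close> by twice
  that weight. Optimality of \<open>X0\<close> then identifies \<open>X0\<close> with
  \<open>V\<close>.\<close>

lemma eigval_gap_quadratic_growth:
  assumes n: "n \<ge> 2" and G: "G \<in> sym_mats n" and X0: "X0 \<in> spectrahedron n"
    and opt: "\<And>Y. Y \<in> spectrahedron n \<Longrightarrow> 0 \<le> inner_mat (Y - X0) G"
    and \<delta>: "\<delta> = eigval (n - 1) G - eigval n G" "\<delta> > 0"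
  obtains u where "u \<in> carrier_vec n" "u \<bullet> u = 1" "X0 = outer_sq u"
    "\<And>X. X \<in> spectrahedron n \<Longrightarrow> \<delta> / 2 * (frob_norm (X - X0))\<^sup>2 \<le> inner_mat (X - X0) G"
proof -
  have Gc: "G \<in> carrier_mat n n" using G by (simp add: sym_mats_def)
  obtain U :: "nat \<Rightarrow> real vec" and d where U: "\<And>i. i < n \<Longrightarrow> U i \<in> carrier_vec n"
    and UU: "\<And>i. i < n \<Longrightarrow> U i \<bullet> U i = 1"
    and UG: "\<And>i. i < n \<Longrightarrow> U i \<bullet> (G *\<^sub>v U i) = d i"
    and trU: "\<And>X. X \<in> carrier_mat n n \<Longrightarrow> (\<Sum>i<n. U i \<bullet> (X *\<^sub>v U i)) = trace_mat X"
    and inn: "\<And>X. X \<in> carrier_mat n n \<Longrightarrow> inner_mat X G = (\<Sum>i<n. d i * (U i \<bullet> (X *\<^sub>v U i)))"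
    and cp: "char_poly G = (\<Prod>a\<leftarrow>map d [0..<n]. [:- a, 1:])"
    by (rule sym_mats_spectral[OF G], rule that) assumption+
  obtain k where k: "k < n" and dk: "d k = eigval n G"
    and di: "\<And>i. i < n \<Longrightarrow> i \<noteq> k \<Longrightarrow> eigval (n - 1) G \<le> d i"
    by (rule eigval_simple_minimum[OF cp n], rule that) assumption+
  define V where "V = outer_sq (U k)"
  have V: "V \<in> spectrahedron n" unfolding V_def by (rule outer_sq_spectrahedron[OF U[OF k] UU[OF k]])
  have car: "X \<in> carrier_mat n n" if "X \<in> spectrahedron n" for X
    using that by (simp add: spectrahedron_def sym_mats_def)
  have VG: "inner_mat V G = d k" unfolding V_def by (simp add: inner_outer_sq[OF Gc U[OF k]] UG[OF k])
  have gap: "\<delta> * (1 - U k \<bullet> (X *\<^sub>v U k)) \<le> inner_mat (X - V) G" if X: "X \<in> spectrahedron n" for X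
  proof -
    define w where "w i = U i \<bullet> (X *\<^sub>v U i)" for i
    have w0: "0 \<le> w i" if "i < n" for i
      using X U[OF that] by (simp add: w_def spectrahedron_def psd_def)
    have "(\<Sum>i<n. w i) = 1"
      using trU[OF car[OF X]] X by (simp add: w_def spectrahedron_def)
    then have w1: "(\<Sum>i\<in>{..<n} - {k}. w i) = 1 - w k"
      using k by (simp add: sum.remove[of _ k])
    \<comment> \<open>\<open>d k + \<delta>\<close> is the second smallest eigenvalue, a lower bound
      for every \<open>d i\<close> with \<open>i\<close> different from \<open>k\<close>.\<close>
    have "(d k + \<delta>) * (1 - w k) = (\<Sum>i\<in>{..<n} - {k}. (d k + \<delta>) * w i)"
      by (simp add: w1 flip: sum_distrib_left)
    also have "\<dots> \<le> (\<Sum>i\<in>{..<n} - {k}. d i * w i)"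
      using di w0 by (intro sum_mono mult_right_mono) (auto simp: \<delta>(1) dk)
    also have "\<dots> = inner_mat X G - d k * w k"
      using k by (simp add: inn[OF car[OF X]] w_def sum.remove[of _ k])
    finally show ?thesis
      by (simp add: inner_mat_diff_left[OF car[OF X] car[OF V] Gc] VG w_def algebra_simps)
  qed
  have growth: "\<delta> / 2 * (frob_norm (X - V))\<^sup>2 \<le> inner_mat (X - V) G" if X: "X \<in> spectrahedron n" for X
  proof -
    have "\<delta> / 2 * (frob_norm (X - V))\<^sup>2 \<le> \<delta> / 2 * (2 * (1 - U k \<bullet> (X *\<^sub>v U k)))"
      unfolding V_def
      by (rule mult_left_mono[OF frob_norm_diff_outer_sq[OF X U[OF k] UU[OF k]]]) (use \<delta>(2) in simp)
    also have "\<dots> = \<delta> * (1 - U k \<bullet> (X *\<^sub>v U k))" by simp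
    also note gap[OF X]
    finally show ?thesis .
  qed
  have D: "X0 - V \<in> carrier_mat n n" using car[OF V] by (simp add: minus_carrier_mat)
  \<comment> \<open>Testing optimality of \<open>X0\<close> at \<open>V\<close> gives the sign
    opposite to the growth bound, so the distance vanishes.\<close>
  have "inner_mat (X0 - V) G \<le> 0"
    using opt[OF V] by (simp add: inner_mat_diff_left[OF car[OF X0] car[OF V] Gc]
        inner_mat_diff_left[OF car[OF V] car[OF X0] Gc])
  then have "\<delta> / 2 * (frob_norm (X0 - V))\<^sup>2 \<le> 0" using growth[OF X0] by linarith
  then have "inner_mat (X0 - V) (X0 - V) = 0"
    using \<delta>(2) by (simp add: mult_le_0_iff flip: frob_norm_power2[OF D])
  then have z: "X0 - V = 0\<^sub>m n n" by (rule inner_mat_self_eq_0[OF D])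
  have "X0 = V"
  proof (rule eq_matI)
    fix i j assume "i < dim_row V" "j < dim_col V"
    then show "X0 $$ (i, j) = V $$ (i, j)"
      using arg_cong[OF z, of "\<lambda>M. M $$ (i, j)"] car[OF X0] car[OF V] by auto
  qed (use car[OF X0] car[OF V] in auto)
  then show thesis using that[OF U[OF k] UU[OF k]] growth by (simp add: V_def)
qed

section \<open>Smooth convex functions on symmetric matrices\<close>

lemma smooth_fun_gradient:
  assumes "smooth_fun n \<beta> q" "X \<in> sym_mats n"
  shows "is_gradient n q X (grad n q X)"
proof -
  obtain G where "is_gradient n q X G" using assms by (auto simp: smooth_fun_def)
  then show ?thesis by (simp add: grad_eq)
qed

lemma smooth_fun_has_line_derivative:
  assumes q: "smooth_fun n \<beta> q" and X: "X \<in> sym_mats n" and D: "D \<in> sym_mats n"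
  shows "((\<lambda>s. q (X + s \<cdot>\<^sub>m D)) has_real_derivative
    inner_mat D (grad n q (X + s \<cdot>\<^sub>m D))) (at s)"
  unfolding DERIV_def
proof (rule LIM_I)
  fix r :: real assume r: "0 < r"
  let ?Y = "X + s \<cdot>\<^sub>m D"
  let ?G = "grad n q ?Y"
  have Y: "?Y \<in> sym_mats n" by (intro sym_mats_add sym_mats_smult X D)
  have gr: "is_gradient n q ?Y ?G" by (rule smooth_fun_gradient[OF q Y])
  have Dc: "D \<in> carrier_mat n n" and Gc: "?G \<in> carrier_mat n n" and Xc: "X \<in> carrier_mat n n"
    using gr D X by (auto simp: is_gradient_def sym_mats_def)
  define F where "F = frob_norm D"
  have F: "F \<ge> 0" using frob_norm_nonneg[OF Dc] by (simp add: F_def)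
  \<comment> \<open>Adding 1 to \<open>F\<close> avoids division by zero when \<open>D\<close> is
    the zero matrix and makes \<open>e * F\<close> strictly smaller than \<open>r\<close>.\<close>
  define e where "e = r / (F + 1)"
  have e: "e > 0" using r F by (simp add: e_def)
  obtain d where d: "d > 0" and dH: "\<And>H. H \<in> sym_mats n \<Longrightarrow> frob_norm H < d \<Longrightarrow>
      \<bar>q (?Y + H) - q ?Y - inner_mat H ?G\<bar> \<le> e * frob_norm H"
    using gr e unfolding is_gradient_def by meson
  show "\<exists>d>0. \<forall>h. h \<noteq> 0 \<and> norm (h - 0) < d \<longrightarrow>
      norm ((q (X + (s + h) \<cdot>\<^sub>m D) - q ?Y) / h - inner_mat D ?G) < r"
  proof (intro exI[of _ "d / (F + 1)"] conjI allI impI)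
    show "0 < d / (F + 1)" using d F by simp
    fix h :: real assume "h \<noteq> 0 \<and> norm (h - 0) < d / (F + 1)"
    then have h: "h \<noteq> 0" "\<bar>h\<bar> * (F + 1) < d" using F by (auto simp: field_simps)
    have "\<bar>h\<bar> * F \<le> \<bar>h\<bar> * (F + 1)" by (intro mult_left_mono) auto
    then have "frob_norm (h \<cdot>\<^sub>m D) < d"
      using h(2) unfolding frob_norm_smult[OF Dc] F_def by linarith
    from dH[OF sym_mats_smult[OF D] this]
    have "\<bar>q (?Y + h \<cdot>\<^sub>m D) - q ?Y - h * inner_mat D ?G\<bar> \<le> e * (\<bar>h\<bar> * F)"
      by (simp add: inner_mat_smult_left[OF Dc Gc] frob_norm_smult[OF Dc] F_def)
    moreover have "?Y + h \<cdot>\<^sub>m D = X + (s + h) \<cdot>\<^sub>m D"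
      using Xc Dc by (intro eq_matI) (auto simp: algebra_simps)
    moreover have "e * (\<bar>h\<bar> * F) < r * \<bar>h\<bar>"
      using h r F by (simp add: e_def field_simps)
    ultimately have "\<bar>q (X + (s + h) \<cdot>\<^sub>m D) - q ?Y - h * inner_mat D ?G\<bar> < r * \<bar>h\<bar>" by simp
    moreover have "(q (X + (s + h) \<cdot>\<^sub>m D) - q ?Y) / h - inner_mat D ?G
        = (q (X + (s + h) \<cdot>\<^sub>m D) - q ?Y - h * inner_mat D ?G) / h"
      using h by (simp add: field_simps)
    ultimately show "norm ((q (X + (s + h) \<cdot>\<^sub>m D) - q ?Y) / h - inner_mat D ?G) < r"
      using h by (simp add: abs_divide pos_divide_less_eq)
  qed
qed

text \<open>In place of integrating the gradient along the segment, the upper model is subtracted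
  from \<open>q\<close> to form \<psi>. Its derivative is nonpositive for \<open>s \<ge> 0\<close>
  by Cauchy-Schwarz and the Lipschitz bound, and \<open>\<psi> 1 \<le> \<psi> 0\<close> is the
  claim.\<close>

lemma smooth_fun_descent:
  assumes q: "smooth_fun n \<beta> q" and X: "X \<in> sym_mats n" and D: "D \<in> sym_mats n"
  shows "q (X + D) \<le> q X + inner_mat D (grad n q X) + \<beta> / 2 * (frob_norm D)\<^sup>2"
proof -
  define g where "g s = inner_mat D (grad n q (X + s \<cdot>\<^sub>m D))" for s
  define \<psi> where "\<psi> s = q (X + s \<cdot>\<^sub>m D) - s * g 0 - \<beta> / 2 * (frob_norm D)\<^sup>2 * s\<^sup>2" for s
  have Dc: "D \<in> carrier_mat n n" and Xc: "X \<in> carrier_mat n n"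
    using D X by (auto simp: sym_mats_def)
  have sY: "X + s \<cdot>\<^sub>m D \<in> sym_mats n" for s by (intro sym_mats_add sym_mats_smult X D)
  have Gs: "grad n q (X + s \<cdot>\<^sub>m D) \<in> sym_mats n" for s
    using smooth_fun_gradient[OF q sY] by (simp add: is_gradient_def)
  have zero: "X + 0 \<cdot>\<^sub>m D = X" "X + 1 \<cdot>\<^sub>m D = X + D"
    using Xc Dc by (auto intro!: eq_matI)
  have der: "(\<psi> has_real_derivative (g s - g 0 - \<beta> * (frob_norm D)\<^sup>2 * s)) (at s)" for s
    unfolding \<psi>_def
    by (auto intro!: derivative_eq_intros smooth_fun_has_line_derivative[OF q X D] simp: g_def)
  have nonpos: "g s - g 0 - \<beta> * (frob_norm D)\<^sup>2 * s \<le> 0" if "0 \<le> s" for s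
  proof -
    let ?E = "grad n q (X + s \<cdot>\<^sub>m D) - grad n q (X + 0 \<cdot>\<^sub>m D)"
    have "g s - g 0 = inner_mat D ?E"
      unfolding g_def by (rule inner_mat_diff_right[symmetric, where n = n])
        (auto simp: Dc sym_mats_carrier Gs)
    also have "\<dots> \<le> frob_norm D * frob_norm ?E"
      using inner_mat_cauchy_schwarz[OF Dc, of ?E] sym_mats_carrier[OF sym_mats_diff[OF Gs Gs]]
      by (meson abs_le_D1)
    also have "\<dots> \<le> frob_norm D * (\<beta> * frob_norm ((X + s \<cdot>\<^sub>m D) - (X + 0 \<cdot>\<^sub>m D)))"
      using q sY frob_norm_nonneg[OF Dc] unfolding smooth_fun_def by (intro mult_left_mono) auto
    also have "(X + s \<cdot>\<^sub>m D) - (X + 0 \<cdot>\<^sub>m D) = s \<cdot>\<^sub>m D"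
      using Xc Dc by (intro eq_matI) auto
    also have "frob_norm D * (\<beta> * frob_norm (s \<cdot>\<^sub>m D)) = \<beta> * (frob_norm D)\<^sup>2 * s"
      using that by (simp add: frob_norm_smult[OF Dc] power2_eq_square)
    finally show ?thesis by simp
  qed
  have "\<psi> 1 \<le> \<psi> 0"
  proof (rule DERIV_nonpos_imp_nonincreasing[where f = \<psi>])
    show "\<exists>y. (\<psi> has_real_derivative y) (at s) \<and> y \<le> 0" if "0 \<le> s" for s
      by (intro exI conjI) (rule der, rule nonpos[OF that])
  qed simp
  then show ?thesis by (simp add: \<psi>_def zero g_def)
qed

text \<open>By convexity each difference quotient from \<open>X\<close> towards \<open>Y\<close>
  with step in (0, 1) is at most \<open>q Y - q X\<close>; the limit from the right is the
  directional derivative.\<close>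

lemma smooth_convex_gradient_ineq:
  assumes q: "smooth_fun n \<beta> q" and cq: "convex_fun n q"
    and X: "X \<in> sym_mats n" and Y: "Y \<in> sym_mats n"
  shows "inner_mat (Y - X) (grad n q X) \<le> q Y - q X"
proof -
  define D where "D = Y - X"
  have D: "D \<in> sym_mats n" unfolding D_def by (rule sym_mats_diff[OF Y X])
  have Dc: "D \<in> carrier_mat n n" and Xc: "X \<in> carrier_mat n n" and Yc: "Y \<in> carrier_mat n n"
    using D X Y by (auto simp: sym_mats_def)
  have zero: "X + 0 \<cdot>\<^sub>m D = X" using Xc Dc by (auto intro!: eq_matI)
  have "((\<lambda>h. (q (X + h \<cdot>\<^sub>m D) - q X) / h) \<longlongrightarrow> inner_mat D (grad n q X)) (at 0)"
    using smooth_fun_has_line_derivative[OF q X D, of 0] by (simp add: DERIV_def zero)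
  then have "((\<lambda>h. (q (X + h \<cdot>\<^sub>m D) - q X) / h) \<longlongrightarrow> inner_mat D (grad n q X)) (at_right 0)"
    by (rule filterlim_mono) (auto simp: at_le)
  moreover have "eventually (\<lambda>h. (q (X + h \<cdot>\<^sub>m D) - q X) / h \<le> q Y - q X) (at_right (0::real))"
    unfolding eventually_at_right_field
  proof (intro exI[of _ 1] conjI allI impI)
    fix h :: real assume "0 < h" "h < 1"
    have "X + h \<cdot>\<^sub>m D = (1 - h) \<cdot>\<^sub>m X + h \<cdot>\<^sub>m Y"
      unfolding D_def using Xc Yc by (intro eq_matI) (auto simp: algebra_simps)
    then have "q (X + h \<cdot>\<^sub>m D) \<le> (1 - h) * q X + h * q Y"
      using cq X Y \<open>0 < h\<close> \<open>h < 1\<close> unfolding convex_fun_def by simp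
    then show "(q (X + h \<cdot>\<^sub>m D) - q X) / h \<le> q Y - q X"
      using \<open>0 < h\<close> by (simp add: field_simps)
  qed simp
  ultimately show ?thesis unfolding D_def
    by (rule tendsto_upperbound) simp
qed

section \<open>Convergence of the regularized Frank-Wolfe iteration\<close>

lemma rfw_iterates_spectrahedron:
  assumes X: "rfw_iterates n q \<beta> \<delta>h X" and "0 < \<beta>" "0 < \<delta>h" and t: "t \<ge> 1"
  shows "X t \<in> spectrahedron n"
  using t
proof (induction t rule: dec_induct)
  case base
  show ?case using X by (simp add: rfw_iterates_def Let_def)
next
  case (step t)
  define \<eta> where "\<eta> = rfw_step \<beta> \<delta>h"
  have \<eta>: "0 \<le> \<eta>" "\<eta> \<le> 1" using assms(2,3) by (auto simp: \<eta>_def rfw_step_def)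
  obtain v where v: "v \<in> carrier_vec n" "l2_norm v = 1"
    and step_eq: "X (t + 1) = (1 - \<eta>) \<cdot>\<^sub>m X t + \<eta> \<cdot>\<^sub>m outer_sq v"
    using X step.hyps(1) unfolding rfw_iterates_def Let_def is_arg_min_def \<eta>_def by blast
  have "outer_sq v \<in> spectrahedron n"
    using v by (intro outer_sq_spectrahedron) (auto simp: l2_norm_eq_1)
  then show ?case using spectrahedron_convex[OF step.IH _ \<eta>] step_eq by simp
qed

text \<open>The exact minimizer \<open>v\<close> is compared with the competitor \<open>u\<close>,
  whose linear term is controlled by convexity of \<open>q\<close> and whose quadratic term is
  controlled by growth of \<open>f\<close>. Passing between the gaps of \<open>f\<close> and
  \<open>q\<close> costs the error in \<alpha>.\<close>

lemma rfw_gap_contraction: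
  assumes q: "smooth_approx n \<alpha> \<beta> f q" and X: "rfw_iterates n q \<beta> \<delta>h X"
    and pos: "0 < \<beta>" "0 < \<delta>h" and t: "t \<ge> 1"
    and u: "u \<in> carrier_vec n" "u \<bullet> u = 1" and X0: "X0 = outer_sq u"
    and growth: "\<And>Y. Y \<in> spectrahedron n \<Longrightarrow> \<delta>h / 2 * (frob_norm (Y - X0))\<^sup>2 \<le> f Y - f X0"
  defines "\<eta> \<equiv> rfw_step \<beta> \<delta>h"
  shows "q (X (t + 1)) - q X0 \<le> (1 - \<eta> / 2) * (q (X t) - q X0) + \<eta> * \<alpha>"
proof -
  have sm: "smooth_fun n \<beta> q" and cq: "convex_fun n q"
    and fq: "\<And>Y. Y \<in> sym_mats n \<Longrightarrow> \<bar>f Y - q Y\<bar> \<le> \<alpha>"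
    using q by (auto simp: smooth_approx_def)
  have \<eta>: "0 \<le> \<eta>" using pos by (auto simp: \<eta>_def rfw_step_def)
  \<comment> \<open>This is where the choice of step size enters: it leaves \<open>u\<close> a
    quadratic term of at most half the growth bound.\<close>
  have \<eta>\<beta>: "\<eta> * \<beta> \<le> \<delta>h / 2" using pos by (auto simp: \<eta>_def rfw_step_def min_def field_simps)
  obtain v where am: "is_arg_min
         (\<lambda>w. inner_mat (outer_sq w) (grad n q (X t))
              + \<eta> * \<beta> / 2 * (frob_norm (outer_sq w - X t))\<^sup>2)
         (\<lambda>w. w \<in> carrier_vec n \<and> l2_norm w = 1) v"
    and step_eq: "X (t + 1) = (1 - \<eta>) \<cdot>\<^sub>m X t + \<eta> \<cdot>\<^sub>m outer_sq v"
    using X t unfolding rfw_iterates_def Let_def \<eta>_def by blast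
  let ?V = "outer_sq v"
  let ?G = "grad n q (X t)"
  have v: "v \<in> carrier_vec n" using am by (simp add: is_arg_min_def)
  have Xt: "X t \<in> spectrahedron n" by (rule rfw_iterates_spectrahedron[OF X pos t])
  have s: "X t \<in> sym_mats n" "?V \<in> sym_mats n" "X0 \<in> sym_mats n"
    using spectrahedron_sym[OF Xt] outer_sq_sym v u X0 by auto
  have Gs: "?G \<in> sym_mats n" using smooth_fun_gradient[OF sm s(1)] by (simp add: is_gradient_def)
  note c = s[THEN sym_mats_carrier] and Gc = sym_mats_carrier[OF Gs]
  define D where "D = ?V - X t"
  have Ds: "D \<in> sym_mats n" unfolding D_def by (rule sym_mats_diff[OF s(2,1)])
  note Dc = sym_mats_carrier[OF Ds]
  have "X (t + 1) = X t + \<eta> \<cdot>\<^sub>m D"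
    unfolding step_eq D_def using c by (intro eq_matI) (auto simp: algebra_simps)
  then have "q (X (t + 1)) \<le> q (X t) + \<eta> * inner_mat D ?G + \<beta> / 2 * (\<eta> * frob_norm D)\<^sup>2"
    using smooth_fun_descent[OF sm s(1) sym_mats_smult[OF Ds], of \<eta>] \<eta>
    by (simp add: inner_mat_smult_left[OF Dc Gc] frob_norm_smult[OF Dc])
  also have "\<dots> = q (X t) + \<eta> * (inner_mat D ?G + \<eta> * \<beta> / 2 * (frob_norm D)\<^sup>2)"
    by (simp add: algebra_simps power2_eq_square)
  \<comment> \<open>The linear term contributes minus the full gap of \<open>q\<close>. The
    quadratic term contributes at most half the gap of \<open>f\<close>, hence half the gap of
    \<open>q\<close> plus \<alpha>.\<close>
  also have "\<dots> \<le> q (X t) + \<eta> * (\<alpha> - (q (X t) - q X0) / 2)"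
  proof -
    define R where "R = \<delta>h / 2 * (frob_norm (X t - X0))\<^sup>2"
    have "(frob_norm (X0 - X t))\<^sup>2 = (frob_norm (X t - X0))\<^sup>2"
      by (simp add: frob_norm_diff_power2[OF c(3,1)] frob_norm_diff_power2[OF c(1,3)]
          inner_mat_commute[OF c(1,3)])
    then have "\<eta> * \<beta> / 2 * (frob_norm (X0 - X t))\<^sup>2 \<le> R / 2"
      using mult_right_mono[OF \<eta>\<beta>, of "(frob_norm (X t - X0))\<^sup>2"] by (simp add: R_def mult_ac)
    moreover have "inner_mat ?V ?G + \<eta> * \<beta> / 2 * (frob_norm (?V - X t))\<^sup>2
        \<le> inner_mat X0 ?G + \<eta> * \<beta> / 2 * (frob_norm (X0 - X t))\<^sup>2"
      using am u unfolding is_arg_min_linorder X0 by (simp add: l2_norm_eq_1)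
    moreover have "inner_mat X0 ?G - inner_mat (X t) ?G \<le> q X0 - q (X t)"
      using smooth_convex_gradient_ineq[OF sm cq s(1,3)]
      by (simp add: inner_mat_diff_left[OF c(3,1) Gc])
    moreover have "R \<le> f (X t) - f X0" unfolding R_def by (rule growth[OF Xt])
    ultimately have "inner_mat ?V ?G - inner_mat (X t) ?G
        + \<eta> * \<beta> / 2 * (frob_norm (?V - X t))\<^sup>2 \<le> \<alpha> - (q (X t) - q X0) / 2"
      using fq[OF s(1)] fq[OF s(3)] by argo
    then have "inner_mat D ?G + \<eta> * \<beta> / 2 * (frob_norm D)\<^sup>2 \<le> \<alpha> - (q (X t) - q X0) / 2"
      by (simp add: D_def inner_mat_diff_left[OF c(2,1) Gc])
    from mult_left_mono[OF this \<eta>] show ?thesis by simp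
  qed
  finally show ?thesis by (simp add: algebra_simps diff_divide_distrib)
qed

lemma rfw_convergence:
  assumes q: "smooth_approx n \<alpha> \<beta> f q" and X: "rfw_iterates n q \<beta> \<delta>h X"
    and pos: "0 < \<beta>" "0 < \<delta>h"
    and u: "u \<in> carrier_vec n" "u \<bullet> u = 1" and X0: "X0 = outer_sq u"
    and growth: "\<And>Y. Y \<in> spectrahedron n \<Longrightarrow> \<delta>h / 2 * (frob_norm (Y - X0))\<^sup>2 \<le> f Y - f X0"
  shows "f (X (t + 1)) - f X0
    \<le> (f (X 1) - f X0) * exp (- min (1 / 2) (\<delta>h / (4 * \<beta>)) * real t) + 4 * \<alpha>"
proof -
  have fq: "\<bar>f Y - q Y\<bar> \<le> \<alpha>" if "Y \<in> spectrahedron n" for Y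
    using q spectrahedron_sym[OF that] by (auto simp: smooth_approx_def)
  define r where "r = min (1 / 2) (\<delta>h / (4 * \<beta>))"
  have r: "0 \<le> r" "r \<le> 1 / 2" using pos by (auto simp: r_def)
  have \<eta>: "rfw_step \<beta> \<delta>h = 2 * r"
    using pos by (auto simp: r_def rfw_step_def min_def field_simps)
  \<comment> \<open>\<open>2 * \<alpha>\<close> is the fixed point of the one-step recursion;
    subtracting it leaves a pure contraction by \<open>1 - r\<close>, where \<open>r\<close> is half
    the step size.\<close>
  define g where "g s = q (X (s + 1)) - q X0 - 2 * \<alpha>" for s
  have step: "g (Suc s) \<le> (1 - r) * g s" for s
    using rfw_gap_contraction[OF q X pos _ u X0 growth, of "s + 1"]
    by (simp add: \<eta> g_def algebra_simps)
  have g: "g t \<le> (1 - r) ^ t * g 0"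
  proof (induction t)
    case (Suc t)
    have "g (Suc t) \<le> (1 - r) * g t" by (rule step)
    also have "\<dots> \<le> (1 - r) * ((1 - r) ^ t * g 0)" using Suc r by (intro mult_left_mono) auto
    finally show ?case by (simp add: mult.assoc)
  qed simp
  have XS: "X (s + 1) \<in> spectrahedron n" for s
    by (rule rfw_iterates_spectrahedron[OF X pos]) simp
  have X0S: "X0 \<in> spectrahedron n" unfolding X0 by (rule outer_sq_spectrahedron[OF u])
  have h0: "0 \<le> f (X 1) - f X0"
    using pos by (intro order_trans[OF _ growth]) (use XS[of 0] in auto)
  \<comment> \<open>The shift by \<open>2 * \<alpha>\<close> absorbs the error of replacing
    \<open>q\<close> by \<open>f\<close> at both points. As \<open>g 0\<close> may be negative, it
    is replaced by the nonnegative gap of \<open>f\<close> before \<open>1 - r\<close> is enlarged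
    to \<open>exp (- r)\<close>.\<close>
  have "g 0 \<le> f (X 1) - f X0" using fq[OF XS[of 0]] fq[OF X0S] by (simp add: g_def)
  then have "(1 - r) ^ t * g 0 \<le> (1 - r) ^ t * (f (X 1) - f X0)"
    using r by (intro mult_left_mono) auto
  also have "\<dots> \<le> exp (- r) ^ t * (f (X 1) - f X0)"
    using r h0 exp_ge_add_one_self[of "- r"] by (intro mult_right_mono power_mono) auto
  also have "exp (- r) ^ t = exp (- r * real t)"
    using exp_of_nat_mult[of t "- r"] by (simp add: mult.commute)
  finally have "g t \<le> (f (X 1) - f X0) * exp (- r * real t)" using g by (simp add: mult.commute)
  \<comment> \<open>The final \<open>4 * \<alpha>\<close> consists of the shift in \<open>g\<close>
    and another \<open>2 * \<alpha>\<close> for returning from \<open>q\<close> to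
    \<open>f\<close>.\<close>
  then show ?thesis
    using fq[OF XS[of t]] fq[OF X0S] unfolding g_def r_def[symmetric] by linarith
qed

theorem theorem7:
  shows "\<exists>C::real. C > 0 \<and>
    (\<forall>(n::nat) (f :: real mat \<Rightarrow> real) (fstar::real) (\<delta>::real) (q :: real mat \<Rightarrow> real)
       (\<alpha>::real) (\<beta>::real) (\<delta>h::real) (Xstar :: real mat) (Gstar :: real mat)
       (X :: nat \<Rightarrow> real mat).
       n \<ge> 2 \<longrightarrow>
       convex_fun n f \<longrightarrow>
       is_arg_min f (\<lambda>Y. Y \<in> spectrahedron n) Xstar \<longrightarrow>
       fstar = (LEAST y. y \<in> f ` spectrahedron n) \<longrightarrow>
       Gstar \<in> subdifferential n f Xstar \<longrightarrow>
       (\<forall>Y \<in> spectrahedron n. 0 \<le> inner_mat (Y - Xstar) Gstar) \<longrightarrow>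
       \<delta> = eigval (n - 1) Gstar - eigval n Gstar \<longrightarrow> \<delta> > 0 \<longrightarrow>
       \<alpha> > 0 \<longrightarrow> \<beta> > 0 \<longrightarrow> smooth_approx n \<alpha> \<beta> f q \<longrightarrow>
       0 < \<delta>h \<longrightarrow> \<delta>h \<le> \<delta> \<longrightarrow>
       rfw_iterates n q \<beta> \<delta>h X \<longrightarrow>
       (\<forall>t::nat. f (X (t + 1)) - fstar
          \<le> (f (X 1) - fstar) * exp (- min (1 / 2) (\<delta>h / (4 * \<beta>)) * real t) + C * \<alpha>))"
proof (intro exI[of _ 4] conjI allI impI)
  fix n and f :: "real mat \<Rightarrow> real" and fstar \<delta> :: real and q :: "real mat \<Rightarrow> real"
    and \<alpha> \<beta> \<delta>h :: real and X0 G0 :: "real mat" and X :: "nat \<Rightarrow> real mat" and t :: nat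
  assume n: "n \<ge> 2" and min: "is_arg_min f (\<lambda>Y. Y \<in> spectrahedron n) X0"
    and fstar: "fstar = (LEAST y. y \<in> f ` spectrahedron n)"
    and G0: "G0 \<in> subdifferential n f X0"
    and opt: "\<forall>Y \<in> spectrahedron n. 0 \<le> inner_mat (Y - X0) G0"
    and \<delta>: "\<delta> = eigval (n - 1) G0 - eigval n G0" "\<delta> > 0"
    and \<beta>: "\<beta> > 0" and q: "smooth_approx n \<alpha> \<beta> f q" and \<delta>h: "0 < \<delta>h" "\<delta>h \<le> \<delta>"
    and X: "rfw_iterates n q \<beta> \<delta>h X"
  have X0: "X0 \<in> spectrahedron n" and le: "\<And>Y. Y \<in> spectrahedron n \<Longrightarrow> f X0 \<le> f Y"
    using min by (auto simp: is_arg_min_linorder)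
  have "fstar = f X0"
    unfolding fstar using X0 le by (intro Least_equality) auto
  moreover obtain u where u: "u \<in> carrier_vec n" "u \<bullet> u = 1" "X0 = outer_sq u"
    and growth: "\<And>Y. Y \<in> spectrahedron n \<Longrightarrow> \<delta> / 2 * (frob_norm (Y - X0))\<^sup>2 \<le> inner_mat (Y - X0) G0"
    by (rule eigval_gap_quadratic_growth[OF n _ X0 _ \<delta>])
      (use G0 opt in \<open>auto simp: subdifferential_def\<close>)
  \<comment> \<open>The subgradient inequality turns growth of the linear form into growth of
    \<open>f\<close>, and \<open>\<delta>h \<le> \<delta>\<close> weakens its constant to the one
    known to the algorithm.\<close>
  moreover have "\<delta>h / 2 * (frob_norm (Y - X0))\<^sup>2 \<le> f Y - f X0" if Y: "Y \<in> spectrahedron n" for Y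
  proof -
    have "\<delta>h / 2 * (frob_norm (Y - X0))\<^sup>2 \<le> \<delta> / 2 * (frob_norm (Y - X0))\<^sup>2"
      using \<delta>h by (intro mult_right_mono) auto
    also note growth[OF Y]
    also have "inner_mat (Y - X0) G0 \<le> f Y - f X0"
      using G0 spectrahedron_sym[OF Y] by (auto simp: subdifferential_def algebra_simps)
    finally show ?thesis .
  qed
  ultimately show "f (X (t + 1)) - fstar
      \<le> (f (X 1) - fstar) * exp (- min (1 / 2) (\<delta>h / (4 * \<beta>)) * real t) + 4 * \<alpha>"
    using rfw_convergence[OF q X \<beta> \<delta>h(1)] by simp
qed simp

end
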